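(* Let $N\ge 1$ be an integer, $\tau=1/N$, and let $\alpha^0,\dots,\alpha^N$ and $\beta^0,\dots,\beta^N$ be elements of $L^2(\mathcal{M})$. Then $$\sum_{i=0}^{N}w_i\,(D_{tt}\alpha^i,\beta^i)_{\mathcal{M}}=-\sum_{i=1}^{N}\left(D_t\alpha^i,D_t\beta^i\right)_{\mathcal{M}},$$ where $w_0=w_N=\tfrac12$ and $w_i=1$ for $i=1,\dots,N-1$.
   Context: $(\mathcal{M},g)$ is a 2-dimensional connected, oriented, compact, $C^3$-smooth Riemannian manifold and $(\cdot,\cdot)_{\mathcal{M}}$ is the $L^2(\mathcal{M})$ inner product. For a sequence $\alpha^0,\dots,\alpha^N\in L^2(\mathcal{M})$ the difference operators are $D_t\alpha^i=\frac{\alpha^i-\alpha^{i-1}}{\tau}$ for $1\le i\le N$, and $$D_{tt}\alpha^0=\frac{2\alpha^1-2\alpha^0}{\tau^2},\qquad D_{tt}\alpha^i=\frac{\alpha^{i+1}-2\alpha^i+\alpha^{i-1}}{\tau^2}\ (1\le i\le N-1),\qquad D_{tt}\alpha^N=\frac{2\alpha^{N-1}-2\alpha^N}{\tau^2}.$$ *)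

theory Defs
  imports "HOL-Analysis.Analysis"
begin

text \<open>\<open>C\<^sup>k\<close> regularity on a set \<open>S\<close>, intended for open \<open>S\<close>.\<close>

primrec Ck_on :: "nat \<Rightarrow> ('a::real_normed_vector \<Rightarrow> 'b::real_normed_vector) \<Rightarrow> 'a set \<Rightarrow> bool" where
  "Ck_on 0 f S \<longleftrightarrow> continuous_on S f"
| "Ck_on (Suc k) f S \<longleftrightarrow>
     (\<forall>x\<in>S. f differentiable (at x)) \<and>
     (\<forall>v. Ck_on k (\<lambda>x. frechet_derivative f (at x) v) S)"

text \<open>A chart is its domain together with its coordinate map; values of the map outside
  the domain are irrelevant.\<close>

type_synonym 'a chart = "'a set \<times> ('a \<Rightarrow> real^2)"

abbreviation dom_of :: "'a chart \<Rightarrow> 'a set" where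
  "dom_of c \<equiv> fst c"

abbreviation coord :: "'a chart \<Rightarrow> 'a \<Rightarrow> real^2" where
  "coord c \<equiv> snd c"

definition transition :: "'a chart \<Rightarrow> 'a chart \<Rightarrow> real^2 \<Rightarrow> real^2" where
  "transition c d = coord d \<circ> inv_into (dom_of c) (coord c)"

definition jacobian :: "'a chart \<Rightarrow> 'a chart \<Rightarrow> real^2 \<Rightarrow> real^2^2" where
  "jacobian c d x = matrix (frechet_derivative (transition c d) (at x))"

text \<open>Smoothness of the inverse transition maps follows by exchanging the two charts.
  An orientation is given by an atlas whose transition maps all have positive Jacobian
  determinant.\<close>

locale oriented_C3_surface =
  fixes X :: "'a topology" and atlas :: "'a chart set"
  assumes Hausdorff: "Hausdorff_space X"
    and second_countable: "second_countable X"
    and cover: "(\<Union>c\<in>atlas. dom_of c) = topspace X"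
    and dom_open: "\<And>c. c \<in> atlas \<Longrightarrow> openin X (dom_of c)"
    and image_open: "\<And>c. c \<in> atlas \<Longrightarrow> open (coord c ` dom_of c)"
    and chart_homeomorphic: "\<And>c. c \<in> atlas \<Longrightarrow>
      homeomorphic_map (subtopology X (dom_of c)) (top_of_set (coord c ` dom_of c)) (coord c)"
    and transition_C3: "\<And>c d. c \<in> atlas \<Longrightarrow> d \<in> atlas \<Longrightarrow>
      Ck_on 3 (transition c d) (coord c ` (dom_of c \<inter> dom_of d))"
    and orientation: "\<And>c d p. c \<in> atlas \<Longrightarrow> d \<in> atlas \<Longrightarrow> p \<in> dom_of c \<inter> dom_of d \<Longrightarrow>
      det (jacobian c d (coord c p)) > 0"

text \<open>The metric is given by its coefficient matrices: \<open>g c x\<close> is the matrix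
  \<open>(g\<^sub>i\<^sub>j)\<close> in the chart \<open>c\<close> at the coordinate point \<open>x\<close>. On a \<open>C\<^sup>3\<close> manifold the
  transformation law involves first derivatives of the transition maps, so \<open>C\<^sup>2\<close> is
  the highest regularity of the coefficients that does not depend on the charts.\<close>

locale oriented_riemannian_surface = oriented_C3_surface X atlas
  for X :: "'a topology" and atlas :: "'a chart set" +
  fixes g :: "'a chart \<Rightarrow> real^2 \<Rightarrow> real^2^2"
  assumes metric_C2: "\<And>c. c \<in> atlas \<Longrightarrow> Ck_on 2 (g c) (coord c ` dom_of c)"
    and metric_symmetric: "\<And>c x. c \<in> atlas \<Longrightarrow> x \<in> coord c ` dom_of c \<Longrightarrow>
      transpose (g c x) = g c x"
    and metric_positive: "\<And>c x v. c \<in> atlas \<Longrightarrow> x \<in> coord c ` dom_of c \<Longrightarrow> v \<noteq> 0 \<Longrightarrow>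
      v \<bullet> (g c x *v v) > 0"
    and metric_transform: "\<And>c d p. c \<in> atlas \<Longrightarrow> d \<in> atlas \<Longrightarrow> p \<in> dom_of c \<inter> dom_of d \<Longrightarrow>
      g c (coord c p) = transpose (jacobian c d (coord c p)) ** g d (coord d p)
        ** jacobian c d (coord c p)"

text \<open>The Riemannian volume is the Borel measure that is \<open>sqrt (det g) dx\<close> in each chart.
  As countably many charts cover the surface, this determines it uniquely.\<close>

definition riemannian_volume ::
  "'a topology \<Rightarrow> 'a chart set \<Rightarrow> ('a chart \<Rightarrow> real^2 \<Rightarrow> real^2^2) \<Rightarrow> 'a measure \<Rightarrow> bool" where
  "riemannian_volume X atlas g vol \<longleftrightarrow>
     space vol = topspace X \<and>
     sets vol = sigma_sets (topspace X) {U. openin X U} \<and>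
     (\<forall>c\<in>atlas. \<forall>A\<in>sets vol. A \<subseteq> dom_of c \<longrightarrow>
        emeasure vol A = (\<integral>\<^sup>+x\<in>coord c ` A. ennreal (sqrt (det (g c x))) \<partial>lborel))"

text \<open>Elements of \<open>L\<^sup>2\<close> are handled through representatives; \<open>L2_inner\<close> is
  invariant under changes on null sets.\<close>

definition L2 :: "'a measure \<Rightarrow> ('a \<Rightarrow> real) set" where
  "L2 M = {f \<in> borel_measurable M. integrable M (\<lambda>x. (f x)\<^sup>2)}"

definition L2_inner :: "'a measure \<Rightarrow> ('a \<Rightarrow> real) \<Rightarrow> ('a \<Rightarrow> real) \<Rightarrow> real" where
  "L2_inner M f h = (\<integral>x. f x * h x \<partial>M)"

text \<open>\<open>D_t\<close> is meant for \<open>1 \<le> i \<le> N\<close> and \<open>D_tt\<close> for \<open>i \<le> N\<close>.\<close>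

definition D_t :: "real \<Rightarrow> (nat \<Rightarrow> 'a \<Rightarrow> real) \<Rightarrow> nat \<Rightarrow> 'a \<Rightarrow> real" where
  "D_t \<tau> \<alpha> i = (\<lambda>x. (\<alpha> i x - \<alpha> (i - 1) x) / \<tau>)"

definition D_tt :: "nat \<Rightarrow> real \<Rightarrow> (nat \<Rightarrow> 'a \<Rightarrow> real) \<Rightarrow> nat \<Rightarrow> 'a \<Rightarrow> real" where
  "D_tt N \<tau> \<alpha> i = (\<lambda>x.
     if i = 0 then (2 * \<alpha> 1 x - 2 * \<alpha> 0 x) / \<tau>\<^sup>2
     else if i = N then (2 * \<alpha> (N - 1) x - 2 * \<alpha> N x) / \<tau>\<^sup>2
     else (\<alpha> (i + 1) x - 2 * \<alpha> i x + \<alpha> (i - 1) x) / \<tau>\<^sup>2)"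

end

theory Submission
  imports Defs
begin

text \<open>The identity is discrete integration by parts, and it already holds at each point
  \<open>x\<close> for the real sequences \<open>\<alpha> i x\<close> and
  \<open>\<beta> i x\<close>; integrating over the surface then gives the claim. The pointwise part
  is Abel summation (\<open>sum_second_difference_mult\<close>): a second difference is a difference
  of consecutive first differences, so summing against \<open>b\<close> moves one difference onto
  \<open>b\<close>. The end weights 1/2 cancel the factor 2 in \<open>D_tt\<close> at both ends and
  leave one-sided first differences, which are exactly the boundary terms
  (\<open>summation_by_parts_pointwise\<close>). Square integrability makes all products integrable,
  so that sums and integrals may be exchanged.\<close>

lemma sum_second_difference_mult:
  fixes a b :: "nat \<Rightarrow> 'b::comm_ring_1"
  shows "(a 1 - a 0) * b 0 + (\<Sum>i=1..n. (a (i + 1) - 2 * a i + a (i - 1)) * b i)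
    = (a (n + 1) - a n) * b n - (\<Sum>i=1..n. (a i - a (i - 1)) * (b i - b (i - 1)))"
  \<comment> \<open>From \<open>n\<close> to \<open>n + 1\<close> both sides grow by the second
    difference of \<open>a\<close> at \<open>n + 1\<close> times \<open>b (n + 1)\<close>.\<close>
  by (induction n) (simp_all add: algebra_simps)

lemma summation_by_parts_pointwise:
  assumes "N \<ge> 1" and "w 0 = 1 / 2" and "w N = 1 / 2"
    and "\<And>i. 1 \<le> i \<Longrightarrow> i \<le> N - 1 \<Longrightarrow> w i = 1"
  shows "(\<Sum>i=0..N. w i * (D_tt N \<tau> \<alpha> i x * \<beta> i x))
    = - (\<Sum>i=1..N. D_t \<tau> \<alpha> i x * D_t \<tau> \<beta> i x)"
proof -
  \<comment> \<open>The interior indices are now \<open>1..n\<close>, and the right end is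
    \<open>n + 1\<close>.\<close>
  obtain n where n: "N = Suc n"
    using assms(1) by (cases N) auto
  define a where "a i = \<alpha> i x" for i
  define b where "b i = \<beta> i x" for i
  have "(\<Sum>i=0..N. w i * (D_tt N \<tau> \<alpha> i x * \<beta> i x))
      = w 0 * (D_tt N \<tau> \<alpha> 0 x * b 0) + (\<Sum>i=1..n. w i * (D_tt N \<tau> \<alpha> i x * b i))
        + w N * (D_tt N \<tau> \<alpha> N x * b N)"
    by (simp add: n b_def sum.atLeast_Suc_atMost)
  also have "(\<Sum>i=1..n. w i * (D_tt N \<tau> \<alpha> i x * b i))
      = (\<Sum>i=1..n. (a (i + 1) - 2 * a i + a (i - 1)) * b i) / \<tau>\<^sup>2"
    unfolding sum_divide_distrib
    by (intro sum.cong refl) (auto simp: assms(4) D_tt_def a_def n)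
  also have "w 0 * (D_tt N \<tau> \<alpha> 0 x * b 0) = (a 1 - a 0) * b 0 / \<tau>\<^sup>2"
    by (simp add: assms(2) D_tt_def a_def algebra_simps diff_divide_distrib)
  also have "w N * (D_tt N \<tau> \<alpha> N x * b N) = - ((a (n + 1) - a n) * b (n + 1) / \<tau>\<^sup>2)"
  proof -
    define c where "c = (a n - a (n + 1)) / \<tau>\<^sup>2"
    have "D_tt N \<tau> \<alpha> N x = 2 * c"
      by (simp add: c_def D_tt_def a_def n right_diff_distrib diff_divide_distrib)
    then have "w N * (D_tt N \<tau> \<alpha> N x * b N) = c * b N"
      by (simp add: assms(3))
    also have "\<dots> = (a n - a (n + 1)) * b (n + 1) / \<tau>\<^sup>2"
      by (simp add: n c_def)
    also have "(a n - a (n + 1)) * b (n + 1) = - ((a (n + 1) - a n) * b (n + 1))"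
      by (simp add: algebra_simps)
    finally show ?thesis
      by (simp only: minus_divide_left)
  qed
  also have "(a 1 - a 0) * b 0 / \<tau>\<^sup>2
        + (\<Sum>i=1..n. (a (i + 1) - 2 * a i + a (i - 1)) * b i) / \<tau>\<^sup>2
        + - ((a (n + 1) - a n) * b (n + 1) / \<tau>\<^sup>2)
      = - (\<Sum>i=1..N. (a i - a (i - 1)) * (b i - b (i - 1))) / \<tau>\<^sup>2"
  proof -
    \<comment> \<open>Abel summation stops at \<open>n\<close> with boundary term
      \<open>(a (n + 1) - a n) * b n\<close>; together with the right end term it forms the missing
      summand \<open>i = N\<close>.\<close>
    have "(a 1 - a 0) * b 0 + (\<Sum>i=1..n. (a (i + 1) - 2 * a i + a (i - 1)) * b i)
        + - ((a (n + 1) - a n) * b (n + 1)) = - (\<Sum>i=1..N. (a i - a (i - 1)) * (b i - b (i - 1)))"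
      unfolding sum_second_difference_mult by (simp add: n right_diff_distrib)
    then show ?thesis
      by (simp only: minus_divide_left flip: add_divide_distrib)
  qed
  also have "\<dots> = - (\<Sum>i=1..N. D_t \<tau> \<alpha> i x * D_t \<tau> \<beta> i x)"
    by (simp add: D_t_def a_def b_def sum_divide_distrib power2_eq_square)
  finally show ?thesis .
qed

text \<open>The product is dominated by the integrable function
  \<open>(f x)\<^sup>2 + (h x)\<^sup>2\<close>.\<close>

lemma integrable_mult_L2:
  assumes "f \<in> L2 M" and "h \<in> L2 M"
  shows "integrable M (\<lambda>x. f x * h x)"
proof (rule Bochner_Integration.integrable_bound)
  show "integrable M (\<lambda>x. (f x)\<^sup>2 + (h x)\<^sup>2)"
    using assms by (auto simp: L2_def)
  show "(\<lambda>x. f x * h x) \<in> borel_measurable M"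
    using assms by (auto simp: L2_def)
  have "\<bar>u * v\<bar> \<le> u\<^sup>2 + v\<^sup>2" for u v :: real
    using sum_squares_bound[of "\<bar>u\<bar>" "\<bar>v\<bar>"] abs_ge_zero[of "u * v"]
    unfolding power2_abs abs_mult by linarith
  then show "AE x in M. norm (f x * h x) \<le> norm ((f x)\<^sup>2 + (h x)\<^sup>2)"
    by simp
qed

text \<open>On expanding the square, the cross term is integrable by
  \<open>integrable_mult_L2\<close>.\<close>

lemma L2_diff:
  assumes "f \<in> L2 M" and "h \<in> L2 M"
  shows "(\<lambda>x. f x - h x) \<in> L2 M"
  using assms integrable_mult_L2[OF assms]
  by (auto simp: L2_def power2_diff mult.assoc)

lemma L2_add:
  assumes "f \<in> L2 M" and "h \<in> L2 M"
  shows "(\<lambda>x. f x + h x) \<in> L2 M"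
  using assms integrable_mult_L2[OF assms]
  by (auto simp: L2_def power2_sum mult.assoc)

lemma L2_mult_left: "f \<in> L2 M \<Longrightarrow> (\<lambda>x. c * f x) \<in> L2 M"
  by (auto simp: L2_def power_mult_distrib)

lemma L2_divide: "f \<in> L2 M \<Longrightarrow> (\<lambda>x. f x / c) \<in> L2 M"
  using L2_mult_left[of f M "inverse c"] by (simp add: field_simps)

lemma D_t_L2:
  assumes "\<And>i. i \<le> N \<Longrightarrow> \<alpha> i \<in> L2 M" and "i \<le> N"
  shows "D_t \<tau> \<alpha> i \<in> L2 M"
  unfolding D_t_def using assms by (intro L2_divide L2_diff) auto

lemma D_tt_L2:
  assumes "\<And>i. i \<le> N \<Longrightarrow> \<alpha> i \<in> L2 M" and "N \<ge> 1" and "i \<le> N"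
  shows "D_tt N \<tau> \<alpha> i \<in> L2 M"
proof -
  consider "i = 0" | "i = N" "i \<noteq> 0" | "i \<noteq> 0" "i < N"
    using assms(3) by linarith
  then show ?thesis
    using assms(2) by cases (auto simp: D_tt_def intro!: L2_divide L2_diff L2_add L2_mult_left assms(1))
qed

theorem lemma4p2:
  fixes X :: "'a topology" and atlas :: "'a chart set"
    and g :: "'a chart \<Rightarrow> real^2 \<Rightarrow> real^2^2" and vol :: "'a measure"
    and N :: nat and \<tau> :: real and w :: "nat \<Rightarrow> real"
    and \<alpha> \<beta> :: "nat \<Rightarrow> 'a \<Rightarrow> real"
  assumes "oriented_riemannian_surface X atlas g"
    and "compact_space X" and "connected_space X"
    and "riemannian_volume X atlas g vol"
    and "N \<ge> 1" and "\<tau> = 1 / real N"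
    and "\<And>i. i \<le> N \<Longrightarrow> \<alpha> i \<in> L2 vol"
    and "\<And>i. i \<le> N \<Longrightarrow> \<beta> i \<in> L2 vol"
    and "w 0 = 1 / 2" and "w N = 1 / 2"
    and "\<And>i. 1 \<le> i \<Longrightarrow> i \<le> N - 1 \<Longrightarrow> w i = 1"
  shows "(\<Sum>i=0..N. w i * L2_inner vol (D_tt N \<tau> \<alpha> i) (\<beta> i))
    = - (\<Sum>i=1..N. L2_inner vol (D_t \<tau> \<alpha> i) (D_t \<tau> \<beta> i))"
proof -
  \<comment> \<open>The integral of a non-integrable function is 0 by convention, so additivity over
    the sum calls for integrability of each summand.\<close>
  have D_tt: "integrable vol (\<lambda>x. w i * (D_tt N \<tau> \<alpha> i x * \<beta> i x))" if "i \<in> {0..N}" for i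
    using that assms(5,7,8)
    by (intro integrable_mult_right integrable_mult_L2 D_tt_L2) auto
  have D_t: "integrable vol (\<lambda>x. D_t \<tau> \<alpha> i x * D_t \<tau> \<beta> i x)" if "i \<in> {1..N}" for i
    using that assms(7,8) by (intro integrable_mult_L2 D_t_L2[of N]) auto
  have "(\<Sum>i=0..N. w i * L2_inner vol (D_tt N \<tau> \<alpha> i) (\<beta> i))
      = (\<integral>x. (\<Sum>i=0..N. w i * (D_tt N \<tau> \<alpha> i x * \<beta> i x)) \<partial>vol)"
    by (subst Bochner_Integration.integral_sum[OF D_tt]) (simp_all add: L2_inner_def)
  \<comment> \<open>The two integrands agree at every point, not just almost everywhere.\<close>
  also have "\<dots> = (\<integral>x. - (\<Sum>i=1..N. D_t \<tau> \<alpha> i x * D_t \<tau> \<beta> i x) \<partial>vol)"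
    by (simp only: summation_by_parts_pointwise[OF assms(5,9,10,11)])
  also have "\<dots> = - (\<Sum>i=1..N. L2_inner vol (D_t \<tau> \<alpha> i) (D_t \<tau> \<beta> i))"
    unfolding integral_minus
    by (subst Bochner_Integration.integral_sum[OF D_t]) (simp_all add: L2_inner_def)
  finally show ?thesis .
qed

end
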